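(* Let $1<a<b$ be real numbers with $\frac{1}{a}<1-\frac{1}{b}$, and consider the linear cookie-cutter map with two branches $$T:\left[0,\tfrac{1}{a}\right]\cup\left[1-\tfrac{1}{b},1\right]\to[0,1],\qquad T(x)=\begin{cases} ax & \text{if } x\le \frac1a,\\ bx+1-b & \text{if } x\ge 1-\frac1b.\end{cases}$$ Then the Lyapunov spectrum $L:[\log a,\log b]\to\mathbb{R}$ of $T$ is concave if and only if $$\frac{\log b}{\log a}\le \frac{\sqrt{2\log 2}+1}{\sqrt{2\log 2}-1}.$$
   Context: The repeller of $T$ is $\Lambda=\bigcap_{n\ge0}T^{-n}([0,1])$. For $x\in\Lambda$ the Lyapunov exponent is $\lambda(x)=\lim_{n\to\infty}\frac1n\log|(T^n)'(x)|$ whenever the limit exists. The range of $\lambda$ is the interval $[\log a,\log b]$, and the Lyapunov spectrum is the function $L(\alpha)=\dim_H\{x\in\Lambda:\lambda(x)=\alpha\}$ for $\alpha\in[\log a,\log b]$, where $\dim_H$ denotes Hausdorff dimension. *)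

theory Defs
  imports "HOL-Analysis.Analysis"
begin

definition hausdorff_measure :: "real \<Rightarrow> real set \<Rightarrow> ennreal" where
  "hausdorff_measure s E =
     (SUP \<delta>\<in>{0<..}. INF U\<in>{U :: nat \<Rightarrow> real set.
         E \<subseteq> (\<Union>i. U i) \<and> (\<forall>i. bounded (U i) \<and> diameter (U i) \<le> \<delta>)}.
        (\<Sum>i. ennreal (diameter (U i) powr s)))"

definition hausdorff_dim :: "real set \<Rightarrow> real" where
  "hausdorff_dim E = Inf {s. 0 < s \<and> hausdorff_measure s E = 0}"

definition cc_dom :: "real \<Rightarrow> real \<Rightarrow> real set" where
  "cc_dom a b = {0..1/a} \<union> {1 - 1/b..1}"

definition cc_map :: "real \<Rightarrow> real \<Rightarrow> real \<Rightarrow> real" where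
  "cc_map a b x = (if x \<le> 1/a then a * x else b * x + 1 - b)"

definition cc_deriv :: "real \<Rightarrow> real \<Rightarrow> real \<Rightarrow> real" where
  "cc_deriv a b x = (if x \<le> 1/a then a else b)"

definition cc_repeller :: "real \<Rightarrow> real \<Rightarrow> real set" where
  "cc_repeller a b = {x. \<forall>n. (\<forall>k<n. (cc_map a b ^^ k) x \<in> cc_dom a b)
                              \<and> (cc_map a b ^^ n) x \<in> {0..1}}"

text \<open>(T^n)'(x) by the chain rule.\<close>
definition cc_iter_deriv :: "real \<Rightarrow> real \<Rightarrow> nat \<Rightarrow> real \<Rightarrow> real" where
  "cc_iter_deriv a b n x = (\<Prod>k<n. cc_deriv a b ((cc_map a b ^^ k) x))"

definition lyap_level_set :: "real \<Rightarrow> real \<Rightarrow> real \<Rightarrow> real set" where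
  "lyap_level_set a b \<alpha> = {x \<in> cc_repeller a b.
      (\<lambda>n. ln \<bar>cc_iter_deriv a b n x\<bar> / real n) \<longlonglongrightarrow> \<alpha>}"

definition lyap_spectrum :: "real \<Rightarrow> real \<Rightarrow> real \<Rightarrow> real" where
  "lyap_spectrum a b \<alpha> = hausdorff_dim (lyap_level_set a b \<alpha>)"

end

theory Submission
  imports Defs "HOL-Probability.Hoeffding" "HOL-Real_Asymp.Real_Asymp"
begin

text \<open>
  A point of the repeller is coded by the branches its orbit visits, and \<open>\<lambda>(x) = \<alpha>\<close> holds iff the
  branch of slope \<open>b\<close> is visited with frequency \<open>p = (\<alpha> - ln a) / (ln b - ln a)\<close>. The level set then
  has dimension \<open>H(p) / \<alpha>\<close> with \<open>H\<close> the entropy of a coin of bias \<open>p\<close>: from above by covering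
  with those cylinders whose size to the power \<open>s\<close> is much smaller than their coin-tossing
  probability, from below by the mass distribution principle for the coin-tossing measure, which
  lives on the level set by the strong law of large numbers.

  With \<open>A = ln a\<close> and \<open>B = ln b\<close>, the second derivative of \<open>F(\<alpha>) = H(p) / \<alpha>\<close> is
  \<open>- K(\<alpha>) / \<alpha>\<^sup>3\<close> where \<open>K'(\<alpha>) = \<alpha>\<^sup>2 (2\<alpha> - A - B) / ((\<alpha> - A)(B - \<alpha>))\<^sup>2\<close>. Hence \<open>K\<close> is smallest at the
  midpoint, with value \<open>((A + B) / (B - A))\<^sup>2 - 2 ln 2\<close>, and \<open>F\<close> is concave iff this is nonnegative.
\<close>

section \<open>Concavity of the entropy quotient\<close>

text \<open>Only 0 is delicate: there the product is 0, which is its limit from the right. This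
  carries continuity of the entropy to the ends of the interval.\<close>

lemma continuous_on_x_ln_x: "continuous_on {0..} (\<lambda>x::real. x * ln x)"
  unfolding continuous_on_def
proof
  fix x :: real assume "x \<in> {0..}"
  show "((\<lambda>x. x * ln x) \<longlongrightarrow> x * ln x) (at x within {0..})"
  proof (cases "x = 0")
    case True
    have "((\<lambda>x::real. x * ln x) \<longlongrightarrow> 0) (at_right 0)"
      by real_asymp
    then show ?thesis
      using True by (simp add: at_within_Ici_at_right)
  next
    case False
    with \<open>x \<in> {0..}\<close> show ?thesis
      by (intro tendsto_intros) auto
  qed
qed

text \<open>The second derivative test is available only in the open interval, since F' has
  logarithms that blow up at the ends. Contracting all points towards the midpoint gives the
  inequality inside; continuity then lets the contraction tend to the identity.\<close>

lemma concave_on_closure_interval: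
  fixes f :: "real \<Rightarrow> real"
  assumes "A < B" "continuous_on {A..B} f" "concave_on {A<..<B} f"
  shows "concave_on {A..B} f"
  unfolding concave_on_iff
proof (intro conjI ballI allI impI)
  show "convex {A..B}" by simp
  fix x y u v :: real
  assume xy: "x \<in> {A..B}" "y \<in> {A..B}" and uv: "u \<ge> 0" "v \<ge> 0" "u + v = 1"
  define m where "m = (A + B) / 2"
  \<comment> \<open>The shift by 2 keeps the contraction factor 1 / (n + 2) strictly between 0 and
    1, also for n = 0.\<close>
  define z where "z n x = x + (m - x) / real (n + 2)" for n :: nat and x
  have z_in: "z n x \<in> {A<..<B}" if "x \<in> {A..B}" for n x
  proof -
    define t where "t = 1 / real (n + 2)"
    have t: "0 < t" "t < 1" by (auto simp: t_def)
    have z: "z n x = x + t * (m - x)" by (simp add: z_def t_def)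
    have "z n x - A = (1 - t) * (x - A) + t * (m - A)" "B - z n x = (1 - t) * (B - x) + t * (B - m)"
      unfolding z by (simp_all add: algebra_simps)
    moreover have "(1 - t) * (x - A) \<ge> 0" "(1 - t) * (B - x) \<ge> 0" "t * (m - A) > 0" "t * (B - m) > 0"
      using t that \<open>A < B\<close> by (auto simp: m_def)
    ultimately show ?thesis
      unfolding greaterThanLessThan_iff by (smt (verit))
  qed
  have z_lim: "(\<lambda>n. f (z n x)) \<longlonglongrightarrow> f x" if "x \<in> {A..B}" for x
  proof (rule continuous_on_tendsto_compose[OF assms(2)])
    show "(\<lambda>n. z n x) \<longlonglongrightarrow> x"
      unfolding z_def by real_asymp
    show "\<forall>\<^sub>F n in sequentially. z n x \<in> {A..B}"
      using z_in[OF that] by (auto intro!: always_eventually less_imp_le)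
  qed (use that in auto)
  have comb: "u *\<^sub>R x + v *\<^sub>R y \<in> {A..B}"
    using xy uv convexD[of "{A..B}" x y u v] by auto
  \<comment> \<open>The contraction is affine, so it commutes with convex combinations.\<close>
  have z_aff: "z n (u *\<^sub>R x + v *\<^sub>R y) = u *\<^sub>R z n x + v *\<^sub>R z n y" for n
  proof -
    have [simp]: "v = 1 - u" using uv by simp
    define t where "t = 1 / real (n + 2)"
    have z: "z n w = w + t * (m - w)" for w by (simp add: z_def t_def)
    show ?thesis unfolding z by (simp add: algebra_simps)
  qed
  have "u * f (z n x) + v * f (z n y) \<le> f (z n (u *\<^sub>R x + v *\<^sub>R y))" for n
    unfolding z_aff using assms(3) z_in xy uv unfolding concave_on_iff by blast
  moreover have "(\<lambda>n. u * f (z n x) + v * f (z n y)) \<longlonglongrightarrow> u * f x + v * f y"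
    by (intro tendsto_intros z_lim xy)
  ultimately show "u * f x + v * f y \<le> f (u *\<^sub>R x + v *\<^sub>R y)"
    using z_lim[OF comb] by (intro LIMSEQ_le[where X = "\<lambda>n. u * f (z n x) + v * f (z n y)"
      and Y = "\<lambda>n. f (z n (u *\<^sub>R x + v *\<^sub>R y))"]) auto
qed

section \<open>The entropy quotient F and the sign of its second derivative\<close>

definition entropy_quotient :: "real \<Rightarrow> real \<Rightarrow> real \<Rightarrow> real" where
  "entropy_quotient A B x =
     - ((x - A) / (B - A) * ln ((x - A) / (B - A)) + (B - x) / (B - A) * ln ((B - x) / (B - A))) / x"

context
  fixes A B :: real
  assumes AB: "0 < A" "A < B"
begin

text \<open>With N the entropy, the quotient rule gives the numerator x N' - N. There the logarithms
  multiplied by x cancel, and \<open>- M x\<close> remains.\<close>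

private definition "M x = (A * ln ((x - A) / (B - A)) - B * ln ((B - x) / (B - A))) / (B - A)"

private definition "F1 x = - M x / x\<^sup>2"

text \<open>This is x M' - 2 M. Logarithms enter only through \<open>M\<close>, whose derivative is
  rational, so one more differentiation removes them.\<close>

private definition "K x = x\<^sup>2 / ((x - A) * (B - x)) - 2 * M x"

private lemma ln_derivs:
  assumes "A < x" "x < B"
  shows "((\<lambda>x. ln ((x - A) / (B - A))) has_real_derivative 1 / (x - A)) (at x)"
    and "((\<lambda>x. ln ((B - x) / (B - A))) has_real_derivative - (1 / (B - x))) (at x)"
  using assms AB by (auto intro!: derivative_eq_intros simp: divide_simps)

private lemma M_deriv:
  assumes "A < x" "x < B"
  shows "(M has_real_derivative x / ((x - A) * (B - x))) (at x)"
proof -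
  have "(M has_real_derivative (A * (1 / (x - A)) - B * - (1 / (B - x))) / (B - A)) (at x)"
    unfolding M_def[abs_def] using assms AB
    by (intro DERIV_cdivide DERIV_diff DERIV_cmult ln_derivs) auto
  also have "(A * (1 / (x - A)) - B * - (1 / (B - x))) / (B - A) = x / ((x - A) * (B - x))"
    using assms AB by (simp add: divide_simps) (simp add: algebra_simps)
  finally show ?thesis .
qed

private lemma F_deriv:
  assumes "A < x" "x < B"
  shows "(entropy_quotient A B has_real_derivative F1 x) (at x)"
proof -
  define P Q where "P = ln ((x - A) / (B - A))" and "Q = ln ((B - x) / (B - A))"
  define N where "N x = - ((x - A) / (B - A) * ln ((x - A) / (B - A))
    + (B - x) / (B - A) * ln ((B - x) / (B - A)))" for x
  have "(N has_real_derivative - ((1 / (B - A) * P + 1 / (x - A) * ((x - A) / (B - A)))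
      + (- 1 / (B - A) * Q + - (1 / (B - x)) * ((B - x) / (B - A))))) (at x)"
    unfolding N_def[abs_def] P_def Q_def using assms AB
    by (intro DERIV_minus DERIV_add DERIV_mult ln_derivs)
      (auto intro!: derivative_eq_intros simp: divide_simps)
  \<comment> \<open>Differentiating the two logarithms contributes 1 / (B - A) and - 1 / (B - A),
    which cancel.\<close>
  also have "- ((1 / (B - A) * P + 1 / (x - A) * ((x - A) / (B - A)))
      + (- 1 / (B - A) * Q + - (1 / (B - x)) * ((B - x) / (B - A)))) = - (P - Q) / (B - A)"
    using assms AB by (simp add: divide_simps)
  finally have "((\<lambda>x. N x / x) has_real_derivative (- (P - Q) / (B - A) * x - N x * 1) / (x * x)) (at x)"
    using assms AB by (intro DERIV_divide DERIV_ident) auto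
  also have "(- (P - Q) / (B - A) * x - N x * 1) / (x * x) = F1 x"
    unfolding F1_def M_def N_def P_def[symmetric] Q_def[symmetric] using assms AB
    by (simp add: divide_simps power2_eq_square) (simp add: algebra_simps)
  finally show ?thesis
    by (simp add: N_def entropy_quotient_def[abs_def])
qed

private lemma F1_deriv:
  assumes "A < x" "x < B"
  shows "(F1 has_real_derivative - K x / x ^ 3) (at x)"
proof -
  have "(F1 has_real_derivative
     (- (x / ((x - A) * (B - x))) * x\<^sup>2 - - M x * (2 * x)) / (x\<^sup>2 * x\<^sup>2)) (at x)"
    unfolding F1_def[abs_def] using assms AB
    by (intro DERIV_divide DERIV_minus M_deriv) (auto intro!: derivative_eq_intros)
  also have "(- (x / ((x - A) * (B - x))) * x\<^sup>2 - - M x * (2 * x)) / (x\<^sup>2 * x\<^sup>2) = - K x / x ^ 3"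
    unfolding K_def using assms AB
    by (simp add: divide_simps power2_eq_square power3_eq_cube) (simp add: algebra_simps)
  finally show ?thesis .
qed

private lemma K_deriv:
  assumes "A < x" "x < B"
  shows "(K has_real_derivative x\<^sup>2 * (2 * x - A - B) / ((x - A) * (B - x))\<^sup>2) (at x)"
proof -
  have "(K has_real_derivative
     (2 * x * ((x - A) * (B - x)) - x\<^sup>2 * ((B - x) - (x - A))) / (((x - A) * (B - x)) * ((x - A) * (B - x)))
     - 2 * (x / ((x - A) * (B - x)))) (at x)"
    unfolding K_def[abs_def] using assms AB
    by (intro DERIV_diff DERIV_divide DERIV_cmult M_deriv) (auto intro!: derivative_eq_intros)
  also have "(2 * x * ((x - A) * (B - x)) - x\<^sup>2 * ((B - x) - (x - A))) / (((x - A) * (B - x)) * ((x - A) * (B - x)))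
     - 2 * (x / ((x - A) * (B - x))) = x\<^sup>2 * (2 * x - A - B) / ((x - A) * (B - x))\<^sup>2"
    using assms AB by (simp add: divide_simps power2_eq_square) (simp add: algebra_simps)?
  finally show ?thesis .
qed

text \<open>At the midpoint the coin is fair: both logarithms equal - ln 2 and \<open>M\<close>
  collapses to ln 2.\<close>

private lemma K_mid: "K ((A + B) / 2) = ((A + B) / (B - A))\<^sup>2 - 2 * ln 2"
proof -
  have *: "((A + B) / 2 - A) / (B - A) = 1 / 2" "(B - (A + B) / 2) / (B - A) = 1 / 2"
    using AB by (auto simp: field_simps)
  have "K ((A + B) / 2) = ((A + B) / 2)\<^sup>2 / (((B - A) / 2) * ((B - A) / 2)) - 2 * (A * ln (1/2) - B * ln (1/2)) / (B - A)"
    unfolding K_def M_def * by (simp add: field_simps)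
  also have "\<dots> = ((A + B) / (B - A))\<^sup>2 - 2 * ln 2"
    using AB by (simp add: ln_div divide_simps power2_eq_square) (simp add: algebra_simps)
  finally show ?thesis .
qed

private lemma K_ge_mid:
  assumes "A < x" "x < B"
  shows "K ((A + B) / 2) \<le> K x"
proof (cases "x \<le> (A + B) / 2")
  case True
  show ?thesis
  proof (rule DERIV_nonpos_imp_nonincreasing[where f = K, OF True])
    fix y assume y: "x \<le> y" "y \<le> (A + B) / 2"
    with assms AB have "A < y" "y < B" by auto
    then show "\<exists>d. (K has_real_derivative d) (at y) \<and> d \<le> 0"
      using y by (intro exI[of _ "y\<^sup>2 * (2 * y - A - B) / ((y - A) * (B - y))\<^sup>2"] conjI K_deriv)
        (auto intro!: divide_nonpos_nonneg mult_nonneg_nonpos)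
  qed
next
  case False
  show ?thesis
  proof (rule DERIV_nonneg_imp_nondecreasing[where f = K])
    show "(A + B) / 2 \<le> x" using False by simp
    fix y assume y: "(A + B) / 2 \<le> y" "y \<le> x"
    with assms AB have "A < y" "y < B" by auto
    then show "\<exists>d. (K has_real_derivative d) (at y) \<and> d \<ge> 0"
      using y by (intro exI[of _ "y\<^sup>2 * (2 * y - A - B) / ((y - A) * (B - y))\<^sup>2"] conjI K_deriv)
        (auto intro!: divide_nonneg_nonneg mult_nonneg_nonneg)
  qed
qed

private lemma continuous_F: "continuous_on {A..B} (entropy_quotient A B)"
proof -
  have "continuous_on {A..B} (\<lambda>x. (x - A) / (B - A) * ln ((x - A) / (B - A)))"
    using AB by (intro continuous_on_compose2[OF continuous_on_x_ln_x, of _ "\<lambda>x. (x - A) / (B - A)"])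
      (auto intro!: continuous_intros)
  moreover have "continuous_on {A..B} (\<lambda>x. (B - x) / (B - A) * ln ((B - x) / (B - A)))"
    using AB by (intro continuous_on_compose2[OF continuous_on_x_ln_x, of _ "\<lambda>x. (B - x) / (B - A)"])
      (auto intro!: continuous_intros)
  ultimately show ?thesis
    unfolding entropy_quotient_def[abs_def] using AB
    by (intro continuous_on_divide continuous_on_minus continuous_on_add continuous_on_id) auto
qed

text \<open>If \<open>K\<close> were negative at the midpoint m, then F' would increase strictly
  near m. By the mean value theorem F would grow more on the right of m than on the left, against
  concavity at m - e, m, m + e.\<close>

private lemma concave_imp_K_mid_nonneg:
  assumes "concave_on {A..B} (entropy_quotient A B)"
  shows "K ((A + B) / 2) \<ge> 0"
proof (rule ccontr)
  define m where "m = (A + B) / 2"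
  have m: "A < m" "m < B" using AB by (auto simp: m_def)
  assume "\<not> ?thesis"
  then have neg: "K m < 0" by (simp add: m_def)
  have "isCont K m" using K_deriv[OF m] by (rule DERIV_isCont)
  then have "eventually (\<lambda>x. K x < 0) (nhds m)"
    using neg by (intro order_tendstoD(2)[of K "K m"]) (auto simp: isCont_def tendsto_at_iff_tendsto_nhds)
  then obtain d where d: "d > 0" "\<And>x. dist x m < d \<Longrightarrow> K x < 0"
    by (auto simp: eventually_nhds_metric)
  \<comment> \<open>The first bound stays where \<open>K\<close> is negative, the second keeps m - e
    and m + e strictly between \<open>A\<close> and \<open>B\<close>.\<close>
  define e where "e = min (d / 2) ((B - A) / 4)"
  have e: "e > 0" "e < d" "A < m - e" "m + e < B"
    using d AB by (auto simp: e_def m_def min_def field_simps)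
  let ?F = "entropy_quotient A B"
  obtain x1 where x1: "m - e < x1" "x1 < m" "?F m - ?F (m - e) = (m - (m - e)) * F1 x1"
    using MVT2[of "m - e" m ?F F1] F_deriv e m by fastforce
  obtain x2 where x2: "m < x2" "x2 < m + e" "?F (m + e) - ?F m = (m + e - m) * F1 x2"
    using MVT2[of m "m + e" ?F F1] F_deriv e m by fastforce
  have "F1 x1 < F1 x2"
  proof (rule DERIV_pos_imp_increasing[where f = F1])
    show "x1 < x2" using x1 x2 by simp
    fix y assume y: "x1 \<le> y" "y \<le> x2"
    then have "A < y" "y < B" using x1 x2 e by auto
    moreover have "K y < 0" using y x1 x2 e by (intro d) (auto simp: dist_real_def)
    ultimately show "\<exists>d. (F1 has_real_derivative d) (at y) \<and> d > 0"
      using AB by (intro exI[of _ "- K y / y ^ 3"] conjI F1_deriv) (auto simp: divide_less_0_iff)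
  qed
  then have "e * F1 x1 < e * F1 x2" using e by simp
  then have "?F (m - e) / 2 + ?F (m + e) / 2 > ?F m" using x1 x2 by (simp add: field_simps)
  moreover have "?F ((1/2) *\<^sub>R (m - e) + (1/2) *\<^sub>R (m + e)) \<ge> 1/2 * ?F (m - e) + 1/2 * ?F (m + e)"
    using e m assms[unfolded concave_on_iff, THEN conjunct2, rule_format, of "m - e" "m + e" "1/2" "1/2"]
    by simp
  moreover have "(1/2) *\<^sub>R (m - e) + (1/2) *\<^sub>R (m + e) = m"
    by (simp add: field_simps)
  ultimately show False by simp
qed

lemma concave_on_entropy_quotient_iff:
  "concave_on {A..B} (entropy_quotient A B) \<longleftrightarrow>
     B / A \<le> (sqrt (2 * ln 2) + 1) / (sqrt (2 * ln 2) - 1)"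
proof -
  have "concave_on {A..B} (entropy_quotient A B) \<longleftrightarrow> K ((A + B) / 2) \<ge> 0"
  proof
    assume mid: "K ((A + B) / 2) \<ge> 0"
    have "concave_on {A<..<B} (entropy_quotient A B)"
    proof (rule f''_le0_imp_concave)
      fix x assume "x \<in> {A<..<B}"
      then have x: "A < x" "x < B" by auto
      show "(entropy_quotient A B has_real_derivative F1 x) (at x)" by (rule F_deriv[OF x])
      show "(F1 has_real_derivative - K x / x ^ 3) (at x)" by (rule F1_deriv[OF x])
      show "- K x / x ^ 3 \<le> 0" using K_ge_mid[OF x] mid x AB by auto
    qed simp
    then show "concave_on {A..B} (entropy_quotient A B)"
      by (intro concave_on_closure_interval AB continuous_F)
  qed (rule concave_imp_K_mid_nonneg)
  also have "\<dots> \<longleftrightarrow> 2 * ln 2 \<le> ((A + B) / (B - A))\<^sup>2"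
    unfolding K_mid by simp
  also have "\<dots> \<longleftrightarrow> sqrt (2 * ln 2) \<le> (A + B) / (B - A)"
  proof
    show "sqrt (2 * ln 2) \<le> (A + B) / (B - A)" if "2 * ln 2 \<le> ((A + B) / (B - A))\<^sup>2"
      using AB that by (intro real_le_lsqrt) auto
  qed (rule sqrt_le_D)
  also have "\<dots> \<longleftrightarrow> B / A \<le> (sqrt (2 * ln 2) + 1) / (sqrt (2 * ln 2) - 1)"
  proof -
    define s :: real where "s = sqrt (2 * ln 2)"
    \<comment> \<open>Since 2 ln 2 is at least 4/3, the denominator s - 1 is positive and the
      rearrangement preserves the direction of the inequality.\<close>
    have s: "s > 1"
      unfolding s_def using ln2_ge_two_thirds by (intro real_less_rsqrt) auto
    have "s \<le> (A + B) / (B - A) \<longleftrightarrow> s * (B - A) \<le> A + B"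
      using AB by (simp add: pos_le_divide_eq)
    also have "\<dots> \<longleftrightarrow> B * (s - 1) \<le> (s + 1) * A"
      by (simp add: algebra_simps)
    also have "\<dots> \<longleftrightarrow> B / A \<le> (s + 1) / (s - 1)"
      using AB s by (simp add: pos_divide_le_eq pos_le_divide_eq)
    finally show ?thesis by (simp add: s_def)
  qed
  finally show ?thesis .
qed

end

section \<open>Products along symbol sequences\<close>

text \<open>One product serves three purposes: with (a, b) it is the derivative of an iterate, with
  (1 / a, 1 / b) the length of a basic interval, with (1 - q, q) the coin-tossing probability of a
  cylinder.\<close>

definition branch_prod :: "real \<Rightarrow> real \<Rightarrow> (nat \<Rightarrow> bool) \<Rightarrow> nat \<Rightarrow> real" where
  "branch_prod u v w n = (\<Prod>k<n. if w k then v else u)"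

definition ones :: "(nat \<Rightarrow> bool) \<Rightarrow> nat \<Rightarrow> real" where
  "ones w n = (\<Sum>k<n. of_bool (w k))"

lemma branch_prod_0 [simp]: "branch_prod u v w 0 = 1"
  by (simp add: branch_prod_def)

lemma branch_prod_Suc: "branch_prod u v w (Suc n) = branch_prod u v w n * (if w n then v else u)"
  by (simp add: branch_prod_def)

lemma branch_prod_Suc_shift:
  "branch_prod u v w (Suc n) = (if w 0 then v else u) * branch_prod u v (\<lambda>k. w (Suc k)) n"
  by (simp add: branch_prod_def prod.lessThan_Suc_shift del: prod.lessThan_Suc)

lemma branch_prod_pos: "0 < u \<Longrightarrow> 0 < v \<Longrightarrow> 0 < branch_prod u v w n"
  unfolding branch_prod_def by (intro prod_pos) auto

lemma branch_prod_le_power: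
  assumes "0 \<le> u" "0 \<le> v" "u \<le> r" "v \<le> r"
  shows "branch_prod u v w n \<le> r ^ n"
  unfolding branch_prod_def using assms prod_mono[of "{..<n}" "\<lambda>k. if w k then v else u" "\<lambda>_. r"]
  by auto

lemma power_le_branch_prod:
  assumes "0 \<le> r" "r \<le> u" "r \<le> v"
  shows "r ^ n \<le> branch_prod u v w n"
  unfolding branch_prod_def using assms prod_mono[of "{..<n}" "\<lambda>_. r" "\<lambda>k. if w k then v else u"]
  by auto

text \<open>Every logarithm of such a product is affine in the number of visits to the second
  branch, so all exponential rates below depend on one frequency.\<close>

lemma ln_branch_prod:
  assumes "0 < u" "0 < v"
  shows "ln (branch_prod u v w n) = real n * ln u + (ln v - ln u) * ones w n"
proof (induction n)
  case (Suc n)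
  then show ?case
    using assms branch_prod_pos[OF assms, of w n]
    by (auto simp: branch_prod_Suc ln_mult ones_def algebra_simps)
qed (simp add: ones_def)

lemma ln_branch_prod_average_tendsto:
  assumes "0 < u" "0 < v" "(\<lambda>n. ones w n / real n) \<longlonglongrightarrow> q"
  shows "(\<lambda>n. ln (branch_prod u v w n) / real n) \<longlonglongrightarrow> (1 - q) * ln u + q * ln v"
proof -
  have "(\<lambda>n. ln u + (ln v - ln u) * (ones w n / real n)) \<longlonglongrightarrow> ln u + (ln v - ln u) * q"
    by (intro tendsto_intros assms)
  moreover have "eventually (\<lambda>n. ln u + (ln v - ln u) * (ones w n / real n)
      = ln (branch_prod u v w n) / real n) sequentially"
    using eventually_gt_at_top[of 0]
    by eventually_elim (use assms in \<open>simp add: ln_branch_prod field_simps\<close>)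
  ultimately show ?thesis
    by (auto simp: algebra_simps dest: Lim_transform_eventually)
qed

section \<open>Total coin-tossing weights of finite words\<close>

lemma sum_list_weights:
  "(\<Sum>xs | length xs = n. (\<Prod>c\<leftarrow>xs. if c then q else 1 - q)) = (1::real)"
proof (induction n)
  case (Suc n)
  have fin: "finite {xs :: bool list. length xs = n}"
    using finite_lists_length_eq[of "UNIV :: bool set" n] by simp
  have "{xs :: bool list. length xs = Suc n} =
      (\<lambda>xs. True # xs) ` {xs. length xs = n} \<union> (\<lambda>xs. False # xs) ` {xs. length xs = n}"
    by (force simp: length_Suc_conv)
  then have "(\<Sum>xs | length xs = Suc n. (\<Prod>c\<leftarrow>xs. if c then q else 1 - q)) =
      (\<Sum>xs\<in>(\<lambda>xs. True # xs) ` {xs. length xs = n}. (\<Prod>c\<leftarrow>xs. if c then q else 1 - q))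
      + (\<Sum>xs\<in>(\<lambda>xs. False # xs) ` {xs. length xs = n}. (\<Prod>c\<leftarrow>xs. if c then q else 1 - q))"
    using fin by (simp only:) (intro sum.union_disjoint, auto)
  then show ?case
    using Suc.IH by (simp add: sum.reindex flip: sum_distrib_left)
qed simp

text \<open>The words of one length n have total weight at most 1 and contribute at most
  \<open>r ^ n\<close>, so a geometric tail remains. Thanks to the factor
  \<open>r ^ length w\<close>, words of all lengths can be summed at once, even if some are prefixes
  of others.\<close>

lemma sum_finite_list_weights_le:
  fixes q r :: real
  assumes "finite W" "\<And>w. w \<in> W \<Longrightarrow> M \<le> length w" "0 \<le> q" "q \<le> 1" "0 < r" "r < 1"
  shows "(\<Sum>w\<in>W. (\<Prod>c\<leftarrow>w. if c then q else 1 - q) * r ^ length w) \<le> r ^ M / (1 - r)"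
proof -
  define N where "N = Suc (Max (length ` W))"
  have len: "length w < N" if "w \<in> W" for w
    unfolding N_def using that assms(1) by (simp add: le_imp_less_Suc)
  define wt :: "bool list \<Rightarrow> real" where "wt w = (\<Prod>c\<leftarrow>w. if c then q else 1 - q)" for w
  have wt_nonneg: "0 \<le> wt w" for w
    unfolding wt_def using assms by (intro prod_list_nonneg) auto
  have fin: "finite {xs :: bool list. length xs = n}" for n
    using finite_lists_length_eq[of "UNIV :: bool set" n] by simp
  have "(\<Sum>w\<in>W. wt w * r ^ length w) \<le> (\<Sum>w\<in>(\<Union>n\<in>{M..<N}. {w. length w = n}). wt w * r ^ length w)"
    using assms(2) len wt_nonneg assms fin by (intro sum_mono2) auto
  also have "\<dots> = (\<Sum>n\<in>{M..<N}. \<Sum>w | length w = n. wt w * r ^ length w)"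
    using fin by (intro sum.UNION_disjoint) auto
  also have "\<dots> = (\<Sum>n\<in>{M..<N}. r ^ n)"
  proof (intro sum.cong refl)
    fix n
    have "(\<Sum>w | length w = n. wt w * r ^ length w) = (\<Sum>w | length w = n. wt w) * r ^ n"
      by (simp add: sum_distrib_right)
    then show "(\<Sum>w | length w = n. wt w * r ^ length w) = r ^ n"
      by (simp add: wt_def sum_list_weights)
  qed
  also have "\<dots> \<le> r ^ M / (1 - r)"
  \<comment> \<open>For empty \<open>W\<close> the value of \<open>Max {}\<close> gives no relation
    between \<open>M\<close> and \<open>N\<close>; if N < M the sum is empty.\<close>
  proof (cases "M \<le> N")
    case True
    have "(\<Sum>n\<in>{M..<N}. r ^ n) * (1 - r) = r ^ M - r ^ N"
      using True by (induction rule: dec_induct) (simp_all add: distrib_right, simp_all add: algebra_simps)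
    then have "(\<Sum>n\<in>{M..<N}. r ^ n) = (r ^ M - r ^ N) / (1 - r)"
      using assms by (simp add: eq_divide_eq)
    then show ?thesis using assms by (simp add: divide_right_mono)
  qed (use assms in simp)
  finally show ?thesis by (simp add: wt_def)
qed

text \<open>For t = 0 the last hypothesis is vacuous, so vanishing of the measure for all s > 0
  already gives dimension 0. The spectrum at its two endpoints is found this way.\<close>

lemma hausdorff_dim_eqI:
  assumes "0 \<le> t"
    and "\<And>s. t < s \<Longrightarrow> hausdorff_measure s E = 0"
    and "\<And>s. 0 < s \<Longrightarrow> s < t \<Longrightarrow> hausdorff_measure s E \<noteq> 0"
  shows "hausdorff_dim E = t"
proof -
  let ?S = "{s. 0 < s \<and> hausdorff_measure s E = 0}"
  have "t \<le> Inf ?S"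
  proof (rule cInf_greatest)
    show "?S \<noteq> {}" using assms(1) assms(2)[of "t + 1"] by (auto intro!: exI[of _ "t + 1"])
  qed (use assms(3) not_less in blast)
  moreover have "Inf ?S \<le> t"
  proof (rule dense_ge)
    fix s assume "t < s"
    then show "Inf ?S \<le> s"
      using assms(1,2) by (intro cInf_lower bdd_belowI[of _ 0]) auto
  qed
  ultimately show ?thesis unfolding hausdorff_dim_def by simp
qed

section \<open>The coin-tossing measure\<close>

text \<open>Here q is the probability of the branch of slope b. The measure stays on symbol
  sequences; sets of reals reach it through the sequences that code their points.\<close>

definition coin_measure :: "real \<Rightarrow> (nat \<Rightarrow> bool) measure" where
  "coin_measure q = PiM UNIV (\<lambda>_. measure_pmf (bernoulli_pmf q))"

lemma space_coin_measure [simp]: "space (coin_measure q) = UNIV"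
  by (simp add: coin_measure_def space_PiM)

lemma prob_space_coin_measure: "prob_space (coin_measure q)"
  unfolding coin_measure_def by (intro prob_space_PiM) (rule measure_pmf.prob_space_axioms)

lemma measurable_coin [measurable]: "(\<lambda>w. w k) \<in> measurable (coin_measure q) (count_space UNIV)"
proof -
  have "(\<lambda>w. w k) \<in> measurable (coin_measure q) (measure_pmf (bernoulli_pmf q))"
    unfolding coin_measure_def by (rule measurable_component_singleton) simp
  then show ?thesis by (simp add: measurable_def)
qed

lemma measurable_branch_prod [measurable]:
  "(\<lambda>w. branch_prod u v w n) \<in> borel_measurable (coin_measure q)"
  unfolding branch_prod_def by measurable

lemma sets_cylinder [measurable]: "{w. \<forall>k<n. w k = w' k} \<in> sets (coin_measure q)"
proof -
  have "{w \<in> space (coin_measure q). \<forall>k<n. w k = w' k} \<in> sets (coin_measure q)"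
    by measurable
  then show ?thesis by simp
qed

lemma emeasure_cylinder:
  assumes "0 \<le> q" "q \<le> 1"
  shows "emeasure (coin_measure q) {w. \<forall>k<n. w k = w' k} = ennreal (branch_prod (1 - q) q w' n)"
proof -
  interpret product_prob_space "\<lambda>_. measure_pmf (bernoulli_pmf q)" "UNIV :: nat set"
    by unfold_locales
  have "emeasure (coin_measure q) {w. \<forall>k<n. w k = w' k}
      = (\<Prod>k<n. emeasure (measure_pmf (bernoulli_pmf q)) {w' k})"
    using emeasure_PiM_Collect[of "{..<n}" "\<lambda>k. {w' k}"]
    by (simp add: coin_measure_def space_PiM lessThan_def)
  also have "\<dots> = (\<Prod>k<n. ennreal (if w' k then q else 1 - q))"
    using assms by (intro prod.cong) (auto simp: emeasure_pmf_single)
  also have "\<dots> = ennreal (branch_prod (1 - q) q w' n)"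
    unfolding branch_prod_def using assms by (intro prod_ennreal) auto
  finally show ?thesis .
qed

text \<open>Hoeffding's inequality for independent coordinates with values in [0, 1], with the bound
  written as a geometric term so that it can be summed over n.\<close>

lemma prob_ones_deviation_le:
  assumes "0 \<le> q" "q \<le> 1" "\<epsilon> \<ge> 0" "n > 0"
  shows "measure (coin_measure q) {w. \<bar>ones w n - real n * q\<bar> \<ge> real n * \<epsilon>} \<le> 2 * exp (- 2 * \<epsilon>\<^sup>2) ^ n"
proof -
  interpret P: prob_space "coin_measure q" by (rule prob_space_coin_measure)
  let ?X = "\<lambda>k w. of_bool (w k) :: real"
  have coord: "(\<lambda>w. w k) \<in> measurable (coin_measure q) (measure_pmf (bernoulli_pmf q))" for k
    unfolding coin_measure_def by (rule measurable_component_singleton) simp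
  have distr: "distr (coin_measure q) (measure_pmf (bernoulli_pmf q)) (\<lambda>w. w k) = measure_pmf (bernoulli_pmf q)" for k
    unfolding coin_measure_def
    by (rule distr_PiM_component) (auto intro: measure_pmf.prob_space_axioms)
  \<comment> \<open>The joint law of the coordinates is the law of the identity map, that is, the
    product measure itself.\<close>
  have "P.indep_vars (\<lambda>_. measure_pmf (bernoulli_pmf q)) (\<lambda>k w. w k) UNIV"
    by (subst P.indep_vars_iff_distr_eq_PiM) (simp_all add: coord distr restrict_UNIV distr_id flip: coin_measure_def)
  then have "P.indep_vars (\<lambda>_. borel) ?X UNIV"
    by (rule P.indep_vars_compose2) auto
  then have indep: "P.indep_vars (\<lambda>_. borel) ?X {..<n}"
    by (rule P.indep_vars_subset) simp
  have expect: "P.expectation (?X k) = q" for k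
  proof -
    have "P.expectation (?X k) = 
        integral\<^sup>L (distr (coin_measure q) (measure_pmf (bernoulli_pmf q)) (\<lambda>w. w k)) of_bool"
      by (subst integral_distr[OF coord]) auto
    then show ?thesis unfolding distr using assms by simp
  qed
  interpret H: Hoeffding_ineq "coin_measure q" "{..<n}" ?X "\<lambda>_. 0" "\<lambda>_. 1" "\<Sum>k<n. P.expectation (?X k)"
    by unfold_locales (use indep in auto)
  have "measure (coin_measure q) {w. \<bar>ones w n - real n * q\<bar> \<ge> real n * \<epsilon>} 
      \<le> 2 * exp (- 2 * (real n * \<epsilon>)\<^sup>2 / real n)"
    using H.Hoeffding_ineq_abs_ge[of "real n * \<epsilon>"] assms by (simp add: ones_def expect)
  also have "- 2 * (real n * \<epsilon>)\<^sup>2 / real n = real n * (- 2 * \<epsilon>\<^sup>2)"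
    using assms by (simp add: power2_eq_square)
  finally show ?thesis unfolding exp_of_nat_mult .
qed

text \<open>Strong law of large numbers: for each tolerance 1 / (j + 1) the deviation probabilities
  are summable, Borel-Cantelli applies, and countably many null sets are discarded.\<close>

lemma AE_ones_average_tendsto:
  assumes "0 \<le> q" "q \<le> 1"
  shows "AE w in coin_measure q. (\<lambda>n. ones w n / real n) \<longlonglongrightarrow> q"
proof -
  interpret P: prob_space "coin_measure q" by (rule prob_space_coin_measure)
  have [measurable]: "(\<lambda>w. ones w n) \<in> borel_measurable (coin_measure q)" for n
    unfolding ones_def by measurable
  have "AE w in coin_measure q. eventually (\<lambda>n. \<bar>ones w n / real n - q\<bar> < 1 / real (Suc j)) sequentially" for j
  proof -
    let ?\<epsilon> = "1 / real (Suc j)"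
    let ?A = "\<lambda>n. {w. \<bar>ones w n - real n * q\<bar> \<ge> real n * ?\<epsilon>}"
    have meas: "?A n \<in> sets (coin_measure q)" for n
    proof -
      have "{w \<in> space (coin_measure q). \<bar>ones w n - real n * q\<bar> \<ge> real n * ?\<epsilon>} \<in> sets (coin_measure q)"
        by measurable
      then show ?thesis by simp
    qed
    have "AE w in coin_measure q. eventually (\<lambda>n. w \<in> space (coin_measure q) - ?A n) sequentially"
    proof (rule borel_cantelli_AE1[OF meas])
      show "summable (\<lambda>n. measure (coin_measure q) (?A n))"
      proof (rule summable_comparison_test_ev)
        show "summable (\<lambda>n. 2 * exp (- 2 * ?\<epsilon>\<^sup>2) ^ n)"
          by (intro summable_mult summable_geometric) simp
        show "eventually (\<lambda>n. norm (measure (coin_measure q) (?A n)) \<le> 2 * exp (- 2 * ?\<epsilon>\<^sup>2) ^ n) sequentially"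
          using eventually_gt_at_top[of 0]
        proof eventually_elim
          case (elim n)
          then show ?case using prob_ones_deviation_le[OF assms, of ?\<epsilon> n] by simp
        qed
      qed
    qed (simp add: less_top[symmetric])
    then show ?thesis
    proof (rule AE_mp, intro AE_I2 impI)
      fix w assume "eventually (\<lambda>n. w \<in> space (coin_measure q) - ?A n) sequentially"
      then show "eventually (\<lambda>n. \<bar>ones w n / real n - q\<bar> < ?\<epsilon>) sequentially"
        using eventually_gt_at_top[of 0]
      proof eventually_elim
        case (elim n)
        have "\<bar>ones w n / real n - q\<bar> = \<bar>ones w n - real n * q\<bar> / real n"
        proof -
          have "ones w n / real n - q = (ones w n - real n * q) / real n"
            using elim by (simp add: field_simps)
          then show ?thesis by (simp add: abs_divide)
        qed
        then show ?case using elim by (simp add: pos_divide_less_eq mult.commute not_le)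
      qed
    qed
  qed
  then have "AE w in coin_measure q. \<forall>j. eventually (\<lambda>n. \<bar>ones w n / real n - q\<bar> < 1 / real (Suc j)) sequentially"
    by (simp add: AE_all_countable)
  then show ?thesis
  proof (rule AE_mp, intro AE_I2 impI)
    fix w assume *: "\<forall>j. eventually (\<lambda>n. \<bar>ones w n / real n - q\<bar> < 1 / real (Suc j)) sequentially"
    show "(\<lambda>n. ones w n / real n) \<longlonglongrightarrow> q"
    proof (rule tendstoI)
      fix e :: real assume "e > 0"
      then obtain j where "1 / real (Suc j) < e" using nat_approx_posE by blast
      with *[rule_format, of j] show "eventually (\<lambda>n. dist (ones w n / real n) q < e) sequentially"
        by (auto simp: dist_real_def elim!: eventually_mono)
    qed
  qed
qed

section \<open>Upper bound for the Hausdorff dimension\<close>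

locale cookie_cutter =
  fixes a b :: real
  assumes a: "1 < a" and ab: "a < b" and gap: "1 / a < 1 - 1 / b"
begin

lemma b: "1 < b"
  using a ab by simp

text \<open>The threshold is the one in \<open>cc_map\<close>, so the code records which affine
  formula is applied for every real x, not only on the repeller.\<close>

definition code :: "real \<Rightarrow> nat \<Rightarrow> bool" where
  "code x k \<longleftrightarrow> 1 / a < (cc_map a b ^^ k) x"

lemma cc_iter_deriv_eq: "cc_iter_deriv a b n x = branch_prod a b (code x) n"
  unfolding cc_iter_deriv_def branch_prod_def
  by (intro prod.cong) (auto simp: cc_deriv_def code_def)

lemma branch_prod_ab_pos: "0 < branch_prod a b w n"
  using a b by (intro branch_prod_pos) auto

text \<open>Equal codes mean the same affine branch at each step, so differences are multiplied
  exactly by the slopes. This identity yields both the diameter bound for cylinders and the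
  separation of coded points.\<close>

lemma iterate_diff:
  assumes "\<And>k. k < n \<Longrightarrow> code x k = code y k"
  shows "(cc_map a b ^^ n) x - (cc_map a b ^^ n) y = branch_prod a b (code x) n * (x - y)"
  using assms
proof (induction n)
  case (Suc n)
  have "(cc_map a b ^^ Suc n) x - (cc_map a b ^^ Suc n) y
      = (if code x n then b else a) * ((cc_map a b ^^ n) x - (cc_map a b ^^ n) y)"
    using Suc.prems[of n] by (auto simp: code_def cc_map_def algebra_simps)
  then show ?case using Suc by (simp add: branch_prod_Suc)
qed simp

lemma repeller_iterate: "x \<in> cc_repeller a b \<Longrightarrow> (cc_map a b ^^ n) x \<in> {0..1}"
  unfolding cc_repeller_def by blast

lemma level_set_ones_average_tendsto:
  assumes "x \<in> lyap_level_set a b \<alpha>"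
  shows "(\<lambda>n. ones (code x) n / real n) \<longlonglongrightarrow> (\<alpha> - ln a) / (ln b - ln a)"
proof -
  have D: "ln a < ln b" using a ab by simp
  have "(\<lambda>n. ln (branch_prod a b (code x) n) / real n) \<longlonglongrightarrow> \<alpha>"
    using assms branch_prod_ab_pos by (simp add: lyap_level_set_def cc_iter_deriv_eq abs_of_pos)
  then have "(\<lambda>n. (ln (branch_prod a b (code x) n) / real n - ln a) / (ln b - ln a))
      \<longlonglongrightarrow> (\<alpha> - ln a) / (ln b - ln a)"
    using D by (intro tendsto_intros) auto
  moreover have "eventually (\<lambda>n. (ln (branch_prod a b (code x) n) / real n - ln a) / (ln b - ln a)
      = ones (code x) n / real n) sequentially"
    using eventually_gt_at_top[of 0]
  proof eventually_elim
    case (elim n)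
    then have "ln (branch_prod a b (code x) n) / real n - ln a = (ln b - ln a) * (ones (code x) n / real n)"
      using a b by (simp add: ln_branch_prod add_divide_distrib)
    then show ?case using D by simp
  qed
  ultimately show ?thesis by (rule Lim_transform_eventually)
qed

section \<open>Finite words and their cylinders\<close>

lemma branch_prod_code_eq_prod_list:
  "branch_prod u v w n = (\<Prod>c\<leftarrow>map w [0..<n]. if c then v else u)"
  by (induction n) (auto simp: branch_prod_Suc)

text \<open>The reciprocal product bounds the diameter of the cylinder of \<open>u\<close>. The
  extra factor \<open>exp (- \<eta>)\<close> per letter is the margin that makes the sum over good
  words of all lengths converge.\<close>

definition good_word :: "real \<Rightarrow> real \<Rightarrow> real \<Rightarrow> nat \<Rightarrow> bool list \<Rightarrow> bool" where
  "good_word q s \<eta> m u \<longleftrightarrow> m \<le> length u \<and>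
     (1 / (\<Prod>c\<leftarrow>u. if c then b else a)) powr s \<le> (\<Prod>c\<leftarrow>u. if c then q else 1 - q) * exp (- \<eta>) ^ length u"

definition code_cylinder :: "bool list \<Rightarrow> real set" where
  "code_cylinder u = {x \<in> cc_repeller a b. map (code x) [0..<length u] = u}"

text \<open>After \<open>length u\<close> steps both points are still in [0, 1], while their
  distance has grown by exactly the product of the slopes.\<close>

lemma code_cylinder_diff_le:
  assumes "x \<in> code_cylinder u" "y \<in> code_cylinder u"
  shows "\<bar>x - y\<bar> \<le> 1 / (\<Prod>c\<leftarrow>u. if c then b else a)"
proof -
  have eq: "map (code x) [0..<length u] = map (code y) [0..<length u]"
    using assms by (simp add: code_cylinder_def)
  have xy: "x \<in> cc_repeller a b" "y \<in> cc_repeller a b"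
    using assms by (auto simp: code_cylinder_def)
  have "(cc_map a b ^^ length u) x - (cc_map a b ^^ length u) y = branch_prod a b (code x) (length u) * (x - y)"
    using eq by (intro iterate_diff) auto
  moreover have "\<bar>(cc_map a b ^^ length u) x - (cc_map a b ^^ length u) y\<bar> \<le> 1"
    using repeller_iterate[OF xy(1), of "length u"] repeller_iterate[OF xy(2), of "length u"] by auto
  ultimately have "branch_prod a b (code x) (length u) * \<bar>x - y\<bar> \<le> 1"
    using branch_prod_ab_pos[of "code x" "length u"] by (simp add: abs_mult)
  moreover have "branch_prod a b (code x) (length u) = (\<Prod>c\<leftarrow>u. if c then b else a)"
    using assms(1) unfolding branch_prod_code_eq_prod_list by (simp add: code_cylinder_def)
  ultimately show ?thesis
    using branch_prod_ab_pos[of "code x" "length u"] by (simp add: pos_le_divide_eq mult.commute)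
qed

lemma prod_list_ab_ge: "a ^ length u \<le> (\<Prod>c\<leftarrow>u. if c then b else a)"
proof (induction u)
  case (Cons c u)
  then show ?case using a ab by (auto intro!: mult_mono)
qed simp

lemma code_cylinder_diameter:
  shows "bounded (code_cylinder u)"
    and "diameter (code_cylinder u) \<le> 1 / (\<Prod>c\<leftarrow>u. if c then b else a)"
proof -
  show "bounded (code_cylinder u)"
    unfolding bounded_two_points dist_real_def using code_cylinder_diff_le by blast
  have "0 < a ^ length u" using a by simp
  also note prod_list_ab_ge
  finally show "diameter (code_cylinder u) \<le> 1 / (\<Prod>c\<leftarrow>u. if c then b else a)"
    using code_cylinder_diff_le by (intro diameter_le) auto
qed

text \<open>Per letter, the logarithm of weight over size to the power s tends to the right-hand
  side of the bound on \<open>\<eta>\<close>, so long prefixes of the code are good. The bias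
  \<open>q\<close> may differ from the frequency \<open>p\<close>, which lets \<open>p\<close> be 0
  or 1.\<close>

lemma level_set_good_word:
  assumes "x \<in> lyap_level_set a b \<alpha>" "0 < q" "q < 1"
    and p: "p = (\<alpha> - ln a) / (ln b - ln a)"
    and "\<eta> < s * \<alpha> + (p * ln q + (1 - p) * ln (1 - q))"
  obtains u where "good_word q s \<eta> m u" "x \<in> code_cylinder u"
proof -
  let ?P = "branch_prod a b (code x)" and ?W = "branch_prod (1 - q) q (code x)"
  have D: "ln a < ln b" using a ab by simp
  have alpha: "(1 - p) * ln a + p * ln b = \<alpha>"
    using D by (simp add: p divide_simps) (simp add: algebra_simps)
  have ones: "(\<lambda>n. ones (code x) n / real n) \<longlonglongrightarrow> p"
    using level_set_ones_average_tendsto[OF assms(1)] p by simp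
  have "(\<lambda>n. ln (?P n) / real n) \<longlonglongrightarrow> \<alpha>"
    using ln_branch_prod_average_tendsto[OF _ _ ones, of a b] a b alpha by simp
  moreover have "(\<lambda>n. ln (?W n) / real n) \<longlonglongrightarrow> (1 - p) * ln (1 - q) + p * ln q"
    using ln_branch_prod_average_tendsto[OF _ _ ones, of "1 - q" q] assms by simp
  ultimately have "(\<lambda>n. s * (ln (?P n) / real n) + ln (?W n) / real n)
      \<longlonglongrightarrow> s * \<alpha> + ((1 - p) * ln (1 - q) + p * ln q)"
    by (intro tendsto_intros)
  then have "eventually (\<lambda>n. \<eta> < s * (ln (?P n) / real n) + ln (?W n) / real n) sequentially"
    using assms(5) by (intro order_tendstoD(1)) (auto simp: add.commute)
  \<comment> \<open>\<open>Suc m\<close> rather than \<open>m\<close> forces n > 0, so that the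
    divisions by n can be undone.\<close>
  then have "eventually (\<lambda>n. \<eta> < s * (ln (?P n) / real n) + ln (?W n) / real n \<and> Suc m \<le> n) sequentially"
    using eventually_ge_at_top by (rule eventually_conj)
  then obtain n where n: "\<eta> < s * (ln (?P n) / real n) + ln (?W n) / real n" "Suc m \<le> n"
    by (auto simp: eventually_sequentially)
  define u where "u = map (code x) [0..<n]"
  have P: "(\<Prod>c\<leftarrow>u. if c then b else a) = ?P n" and W: "(\<Prod>c\<leftarrow>u. if c then q else 1 - q) = ?W n"
    by (simp_all add: u_def branch_prod_code_eq_prod_list)
  have pos: "0 < ?P n" "0 < ?W n"
    using branch_prod_ab_pos branch_prod_pos[of "1 - q" q] assms by auto
  have "real n * \<eta> \<le> real n * (s * (ln (?P n) / real n) + ln (?W n) / real n)"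
    using n by (intro mult_left_mono) auto
  also have "\<dots> = s * ln (?P n) + ln (?W n)"
    using n by (simp add: field_simps)
  finally have "- s * ln (?P n) \<le> ln (?W n) + real n * (- \<eta>)" by simp
  then have "exp (- s * ln (?P n)) \<le> exp (ln (?W n) + real n * (- \<eta>))" by simp
  also have "\<dots> = ?W n * exp (- \<eta>) ^ n"
    using pos by (simp only: exp_add exp_of_nat_mult exp_ln)
  also have "exp (- s * ln (?P n)) = (1 / ?P n) powr s"
    using pos by (simp add: powr_def ln_div)
  finally have "good_word q s \<eta> m u"
    using n unfolding good_word_def P W by (simp add: u_def)
  moreover have "x \<in> code_cylinder u"
    using assms(1) by (simp add: code_cylinder_def u_def lyap_level_set_def)
  ultimately show ?thesis by (rule that)
qed

text \<open>For each m, the cylinders of good words of length at least m cover the level set. Their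
  diameters are at most \<open>(1 / a) ^ m\<close> and the sum of their powers at most
  \<open>r ^ m / (1 - r)\<close>; both tend to 0.\<close>

lemma hausdorff_measure_level_set_eq_0:
  assumes "0 < q" "q < 1" "0 < s"
    and p: "p = (\<alpha> - ln a) / (ln b - ln a)"
    and "- (p * ln q + (1 - p) * ln (1 - q)) < s * \<alpha>"
  shows "hausdorff_measure s (lyap_level_set a b \<alpha>) = 0"
proof -
  \<comment> \<open>Half the available gap: positive, so that r < 1, and still strictly below the
    limiting rate.\<close>
  define \<eta> where "\<eta> = (s * \<alpha> + (p * ln q + (1 - p) * ln (1 - q))) / 2"
  define r where "r = exp (- \<eta>)"
  have *: "0 < (y + x) / 2 \<and> (y + x) / 2 < y + x" if "- x < y" for x y :: real
    using that by simp
  have eta: "0 < \<eta>" "\<eta> < s * \<alpha> + (p * ln q + (1 - p) * ln (1 - q))"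
    using *[OF assms(5)] by (auto simp: \<eta>_def)
  have r: "0 < r" "r < 1" using eta by (auto simp: r_def)
  let ?E = "lyap_level_set a b \<alpha>"
  have "(INF U\<in>{U :: nat \<Rightarrow> real set. ?E \<subseteq> (\<Union>i. U i) \<and> (\<forall>i. bounded (U i) \<and> diameter (U i) \<le> \<delta>)}.
        (\<Sum>i. ennreal (diameter (U i) powr s))) = 0" (is "Inf (?f ` ?C) = 0") if "\<delta> > 0" for \<delta>
  proof -
    have small: "Inf (?f ` ?C) \<le> ennreal \<epsilon>" if "\<epsilon> > 0" for \<epsilon>
    proof -
      have "(\<lambda>m. r ^ m / (1 - r)) \<longlonglongrightarrow> 0 / (1 - r)"
        using r by (intro tendsto_intros LIMSEQ_power_zero) auto
      then have "eventually (\<lambda>m. r ^ m / (1 - r) < \<epsilon>) sequentially"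
        using \<open>\<epsilon> > 0\<close> by (intro order_tendstoD(2)) auto
      moreover have "(\<lambda>m. (1 / a) ^ m) \<longlonglongrightarrow> 0"
        using a by (intro LIMSEQ_power_zero) auto
      then have "eventually (\<lambda>m. (1 / a) ^ m < \<delta>) sequentially"
        using \<open>\<delta> > 0\<close> by (intro order_tendstoD(2)) auto
      ultimately have "eventually (\<lambda>m. r ^ m / (1 - r) < \<epsilon> \<and> (1 / a) ^ m < \<delta>) sequentially"
        by (rule eventually_conj)
      then obtain m where m: "r ^ m / (1 - r) < \<epsilon>" "(1 / a) ^ m < \<delta>"
        by (auto simp: eventually_sequentially)
      \<comment> \<open>Covers are indexed by naturals, so words are enumerated by
        \<open>from_nat\<close>. The second condition selects one index per word, so each cylinder
        is counted once; all other indices get the empty set, which contributes 0.\<close>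
      define good where "good i \<longleftrightarrow> good_word q s \<eta> m (from_nat i) \<and> to_nat (from_nat i :: bool list) = i" for i
      define U where "U i = (if good i then code_cylinder (from_nat i) else {})" for i
      have "?E \<subseteq> (\<Union>i. U i)"
      proof
        fix x assume "x \<in> ?E"
        then obtain u where "good_word q s \<eta> m u" "x \<in> code_cylinder u"
          using level_set_good_word[OF _ assms(1,2) p eta(2)] by blast
        then have "x \<in> U (to_nat u)" by (simp add: U_def good_def)
        then show "x \<in> (\<Union>i. U i)" by blast
      qed
      moreover have "bounded (U i)" for i
        by (simp add: U_def code_cylinder_diameter)
      moreover have "diameter (U i) \<le> \<delta>" for i
      proof (cases "good i")
        case True
        let ?u = "from_nat i :: bool list"
        have "diameter (U i) \<le> 1 / (\<Prod>c\<leftarrow>?u. if c then b else a)"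
          using True by (simp add: U_def code_cylinder_diameter)
        also have "\<dots> \<le> 1 / a ^ length ?u"
          using a prod_list_ab_ge[of ?u] by (intro divide_left_mono mult_pos_pos) (auto intro: less_le_trans[of _ "a ^ length ?u"])
        also have "\<dots> \<le> (1 / a) ^ m"
          using a True by (simp add: good_def good_word_def power_one_over power_increasing divide_left_mono)
        finally show ?thesis using m by simp
      qed (use \<open>\<delta> > 0\<close> in \<open>simp add: U_def\<close>)
      ultimately have "U \<in> ?C" by blast
      then have "Inf (?f ` ?C) \<le> ?f U" by (rule INF_lower)
      also have "?f U \<le> ennreal \<epsilon>"
      proof (rule suminf_le_const[OF summableI])
        fix n
        let ?wt = "\<lambda>u. (\<Prod>c\<leftarrow>u. if c then q else 1 - q) * r ^ length u"
        have wt_nonneg: "0 \<le> ?wt u" for u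
          using assms(1,2) r by (intro mult_nonneg_nonneg prod_list_nonneg) auto
        have "(\<Sum>i<n. ennreal (diameter (U i) powr s)) = ennreal (\<Sum>i<n. diameter (U i) powr s)"
          by (intro sum_ennreal) auto
        also have "(\<Sum>i<n. diameter (U i) powr s) = (\<Sum>i\<in>{i\<in>{..<n}. good i}. diameter (U i) powr s)"
          using assms(3) by (intro sum.mono_neutral_right) (auto simp: U_def)
        also have "\<dots> \<le> (\<Sum>i\<in>{i\<in>{..<n}. good i}. ?wt (from_nat i))"
        proof (rule sum_mono)
          fix i assume "i \<in> {i\<in>{..<n}. good i}"
          then have good: "good i" by simp
          let ?u = "from_nat i :: bool list"
          have "diameter (U i) powr s \<le> (1 / (\<Prod>c\<leftarrow>?u. if c then b else a)) powr s"
            using good assms(3)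
            by (intro powr_mono2) (auto simp: U_def code_cylinder_diameter diameter_ge_0)
          also have "\<dots> \<le> ?wt ?u" using good by (simp add: good_def good_word_def r_def)
          finally show "diameter (U i) powr s \<le> ?wt ?u" .
        qed
        also have "\<dots> = (\<Sum>u\<in>from_nat ` {i\<in>{..<n}. good i}. ?wt u)"
        proof (rule sum.reindex[symmetric, unfolded o_def])
          show "inj_on (from_nat :: nat \<Rightarrow> bool list) {i \<in> {..<n}. good i}"
            by (rule inj_on_inverseI[where g = to_nat]) (simp add: good_def)
        qed
        also have "\<dots> \<le> r ^ m / (1 - r)"
          using assms r by (intro sum_finite_list_weights_le) (auto simp: good_def good_word_def)
        also have "\<dots> \<le> \<epsilon>" using m by simp
        finally show "(\<Sum>i<n. ennreal (diameter (U i) powr s)) \<le> ennreal \<epsilon>"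
          using ennreal_leI by simp
      qed
      finally show ?thesis .
    qed
    have "Inf (?f ` ?C) \<le> 0"
      by (rule ennreal_le_epsilon) (simp only: add_0 small)
    then show ?thesis by (simp only: le_zero_eq)
  qed
  then show ?thesis
    unfolding hausdorff_measure_def by (auto intro!: antisym SUP_least)
qed

end

section \<open>Lower bound for the Hausdorff dimension\<close>

context cookie_cutter
begin

section \<open>Points with a prescribed code\<close>

definition coding_term :: "(nat \<Rightarrow> bool) \<Rightarrow> nat \<Rightarrow> real" where
  "coding_term w n = of_bool (w n) * (1 - 1 / b) * branch_prod (1 / a) (1 / b) w n"

text \<open>The inverse branches are y / a and 1 - 1 / b + y / b. Composing them along
  \<open>w\<close> gives this series: each visit to the right branch adds its offset 1 - 1 / b,
  shrunk by the earlier contractions.\<close>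

definition coding :: "(nat \<Rightarrow> bool) \<Rightarrow> real" where
  "coding w = (\<Sum>n. coding_term w n)"

lemma coding_term_nonneg: "0 \<le> coding_term w n"
  unfolding coding_term_def using a b
  by (intro mult_nonneg_nonneg less_imp_le[OF branch_prod_pos]) auto

text \<open>The left side is the right endpoint of the basic interval of level n: the partial sum is
  its left endpoint and the product its length.\<close>

lemma sum_coding_term_le: "(\<Sum>k<n. coding_term w k) + branch_prod (1 / a) (1 / b) w n \<le> 1"
proof (induction n)
  case (Suc n)
  have "0 < branch_prod (1 / a) (1 / b) w n" using a b by (intro branch_prod_pos) auto
  then have "coding_term w n + branch_prod (1 / a) (1 / b) w (Suc n) \<le> branch_prod (1 / a) (1 / b) w n"
    using a b by (auto simp: coding_term_def branch_prod_Suc algebra_simps divide_simps)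
  then show ?case using Suc by simp
qed simp

lemma sum_coding_term_le_1: "(\<Sum>k<n. coding_term w k) \<le> 1"
  using sum_coding_term_le[of w n] branch_prod_pos[of "1 / a" "1 / b" w n] a b by simp

lemma summable_coding_term: "summable (coding_term w)"
  using coding_term_nonneg sum_coding_term_le_1 by (rule summableI_nonneg_bounded)

lemma coding_in_unit: "coding w \<in> {0..1}"
  unfolding coding_def
  using suminf_nonneg[OF summable_coding_term coding_term_nonneg]
    suminf_le_const[OF summable_coding_term sum_coding_term_le_1] by auto

lemma coding_shift:
  "coding w = (if w 0 then 1 - 1 / b + coding (\<lambda>k. w (Suc k)) / b else coding (\<lambda>k. w (Suc k)) / a)"
proof -
  have "coding w = coding_term w 0 + (\<Sum>n. coding_term w (Suc n))"
    unfolding coding_def using suminf_split_head[OF summable_coding_term] by simp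
  also have "(\<lambda>n. coding_term w (Suc n)) = (\<lambda>n. (if w 0 then 1 / b else 1 / a) * coding_term (\<lambda>k. w (Suc k)) n)"
    by (auto simp: coding_term_def branch_prod_Suc_shift)
  also have "(\<Sum>n. (if w 0 then 1 / b else 1 / a) * coding_term (\<lambda>k. w (Suc k)) n)
      = (if w 0 then 1 / b else 1 / a) * coding (\<lambda>k. w (Suc k))"
    unfolding coding_def by (rule suminf_mult[OF summable_coding_term])
  finally show ?thesis by (simp add: coding_term_def)
qed

lemma coding_branch:
  shows "w 0 \<Longrightarrow> coding w \<in> {1 - 1 / b..1}" and "\<not> w 0 \<Longrightarrow> coding w \<in> {0..1 / a}"
proof -
  let ?y = "coding (\<lambda>k. w (Suc k))"
  have y: "0 \<le> ?y" "?y \<le> 1" using coding_in_unit[of "\<lambda>k. w (Suc k)"] by auto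
  then have "0 \<le> ?y / a" "?y / a \<le> 1 / a" "0 \<le> ?y / b" "?y / b \<le> 1 / b"
    using a b by (simp_all add: divide_right_mono)
  then show "w 0 \<Longrightarrow> coding w \<in> {1 - 1 / b..1}" and "\<not> w 0 \<Longrightarrow> coding w \<in> {0..1 / a}"
    by (simp_all add: coding_shift[of w])
qed

text \<open>The gap places the whole right interval beyond 1 / a, so the first symbol can be read
  off the point.\<close>

lemma coding_gt_iff: "1 / a < coding w \<longleftrightarrow> w 0"
  using coding_branch[of w] gap by (cases "w 0") auto

lemma cc_map_coding: "cc_map a b (coding w) = coding (\<lambda>k. w (Suc k))"
proof (cases "w 0")
  case True
  then have "\<not> coding w \<le> 1 / a" using coding_gt_iff[of w] by simp
  then show ?thesis using True b by (simp add: cc_map_def coding_shift[of w] distrib_left right_diff_distrib)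
next
  case False
  then have "coding w \<le> 1 / a" using coding_gt_iff[of w] by simp
  then show ?thesis using False a by (simp add: cc_map_def coding_shift[of w])
qed

lemma cc_map_iterate_coding: "(cc_map a b ^^ n) (coding w) = coding (\<lambda>k. w (k + n))"
  by (induction n) (simp_all add: cc_map_coding)

lemma code_coding: "code (coding w) = w"
  by (auto simp: code_def cc_map_iterate_coding coding_gt_iff)

lemma coding_in_dom: "coding w \<in> cc_dom a b"
  using coding_branch[of w] by (cases "w 0") (simp_all add: cc_dom_def)

lemma coding_in_repeller: "coding w \<in> cc_repeller a b"
  using coding_in_unit coding_in_dom by (simp add: cc_repeller_def cc_map_iterate_coding del: atLeastAtMost_iff)

lemma coding_in_level_set:
  assumes "(\<lambda>n. ones w n / real n) \<longlonglongrightarrow> q" "\<alpha> = (1 - q) * ln a + q * ln b"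
  shows "coding w \<in> lyap_level_set a b \<alpha>"
  using ln_branch_prod_average_tendsto[OF _ _ assms(1), of a b] assms(2) a b coding_in_repeller branch_prod_ab_pos
  by (simp add: lyap_level_set_def cc_iter_deriv_eq code_coding abs_of_pos)

text \<open>After n common steps the images lie in different branch intervals, hence at least a gap
  apart; \<open>iterate_diff\<close> scales this distance back.\<close>

lemma coding_separation:
  assumes "\<And>k. k < n \<Longrightarrow> w k = w' k" "w n \<noteq> w' n"
  shows "1 - 1 / a - 1 / b \<le> branch_prod a b w n * \<bar>coding w - coding w'\<bar>"
proof -
  have first: "1 - 1 / a - 1 / b \<le> coding v - coding v'" if "v 0" "\<not> v' 0" for v v'
    using coding_branch(1)[of v] coding_branch(2)[of v'] that by simp
  have "1 - 1 / a - 1 / b \<le> \<bar>coding (\<lambda>k. w (k + n)) - coding (\<lambda>k. w' (k + n))\<bar>"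
    using first[of "\<lambda>k. w (k + n)" "\<lambda>k. w' (k + n)"] first[of "\<lambda>k. w' (k + n)" "\<lambda>k. w (k + n)"] assms(2)
    by (cases "w n") auto
  also have "\<dots> = \<bar>branch_prod a b w n * (coding w - coding w')\<bar>"
    using iterate_diff[of n "coding w" "coding w'"] assms(1) by (simp add: code_coding cc_map_iterate_coding)
  also have "\<dots> = branch_prod a b w n * \<bar>coding w - coding w'\<bar>"
    using branch_prod_ab_pos[of w n] by (simp add: abs_mult)
  finally show ?thesis .
qed

text \<open>A small set \<open>U\<close> cannot separate sequences early, so those of
  \<open>A\<close> coded into it share one cylinder, whose mass is controlled by the diameter. As
  \<open>U\<close> is arbitrary, the set of these sequences may fail to be measurable;
  \<open>C\<close> is a measurable superset.\<close>

lemma mass_of_covering_set: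
  fixes q s :: real and A :: "(nat \<Rightarrow> bool) set" and U :: "real set"
  defines "g \<equiv> 1 - 1 / a - 1 / b"
  assumes q: "0 < q" "q < 1" and s: "0 < s"
    and A: "\<And>w n. w \<in> A \<Longrightarrow> N \<le> n \<Longrightarrow> branch_prod (1 - q) q w n \<le> (1 / branch_prod a b w n) powr s"
    and U: "bounded U" "diameter U \<le> g / b ^ N"
  obtains C where "C \<in> sets (coin_measure q)" "{w \<in> A. coding w \<in> U} \<subseteq> C"
    "emeasure (coin_measure q) C \<le> ennreal ((diameter U / g) powr s)"
proof -
  have g: "0 < g" using gap by (simp add: g_def)
  let ?d = "diameter U"
  have d_nonneg: "0 \<le> ?d" using U by (simp add: diameter_ge_0)
  define V where "V = {w \<in> A. coding w \<in> U}"
  have sep: "g \<le> branch_prod a b w n * ?d"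
    if "w \<in> V" "w' \<in> V" "\<And>k. k < n \<Longrightarrow> w k = w' k" "w n \<noteq> w' n" for w w' n
  proof -
    have "g \<le> branch_prod a b w n * \<bar>coding w - coding w'\<bar>"
      unfolding g_def using that by (intro coding_separation) auto
    also have "\<bar>coding w - coding w'\<bar> \<le> ?d"
      using that diameter_bounded_bound[OF U(1), of "coding w" "coding w'"] by (auto simp: V_def dist_real_def)
    finally show ?thesis using branch_prod_ab_pos[of w n] by simp
  qed
  have agree: "w' k = w k" if "w \<in> V" "w' \<in> V" "k < n" "\<And>j. j < n \<Longrightarrow> branch_prod a b w j * ?d < g" for w w' k n
  proof (rule ccontr)
    assume "w' k \<noteq> w k"
    define j where "j = (LEAST j. w j \<noteq> w' j)"
    have j: "w j \<noteq> w' j"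
      unfolding j_def by (rule LeastI[of "\<lambda>j. w j \<noteq> w' j" k]) (use \<open>w' k \<noteq> w k\<close> in simp)
    have "j \<le> k"
      unfolding j_def by (rule Least_le) (use \<open>w' k \<noteq> w k\<close> in simp)
    have "w i = w' i" if "i < j" for i
      using not_less_Least[of i "\<lambda>j. w j \<noteq> w' j"] that by (simp add: j_def)
    from sep[OF that(1,2) this j] have "g \<le> branch_prod a b w j * ?d" .
    moreover have "branch_prod a b w j * ?d < g"
      using \<open>j \<le> k\<close> that(3) by (intro that(4)) simp
    ultimately show False by simp
  qed
  show ?thesis
  proof (cases "V = {}")
    case True
    then show ?thesis by (intro that[of "{}"]) (auto simp: V_def)
  next
    case False
    then obtain w where w: "w \<in> V" by blast
    then have wA: "w \<in> A" by (simp add: V_def)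
    show ?thesis
    proof (cases "?d = 0")
      case True
      \<comment> \<open>With diameter 0 the required bound is 0. All sequences in \<open>V\<close>
        coincide, and a single sequence is null because max (1 - q) q < 1.\<close>
      have "emeasure (coin_measure q) (\<Inter>n. {w'. \<forall>k<n. w' k = w k}) \<le> 0"
      proof (rule LIMSEQ_le_const)
        show "(\<lambda>n. ennreal (max (1 - q) q ^ n)) \<longlonglongrightarrow> 0"
        proof -
          have "(\<lambda>n. max (1 - q) q ^ n) \<longlonglongrightarrow> 0"
            using q by (intro LIMSEQ_power_zero) auto
          from tendsto_ennrealI[OF this] show ?thesis by simp
        qed
        have "emeasure (coin_measure q) (\<Inter>n. {w'. \<forall>k<n. w' k = w k}) \<le> ennreal (max (1 - q) q ^ n)" for n
        proof -
          have "emeasure (coin_measure q) (\<Inter>n. {w'. \<forall>k<n. w' k = w k}) \<le> emeasure (coin_measure q) {w'. \<forall>k<n. w' k = w k}"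
            by (intro emeasure_mono sets_cylinder) blast
          also have "\<dots> \<le> ennreal (max (1 - q) q ^ n)"
            using q branch_prod_le_power[of "1 - q" q "max (1 - q) q" w n] by (simp add: emeasure_cylinder ennreal_leI)
          finally show ?thesis .
        qed
        then show "\<exists>N. \<forall>n\<ge>N. emeasure (coin_measure q) (\<Inter>n. {w'. \<forall>k<n. w' k = w k}) \<le> ennreal (max (1 - q) q ^ n)"
          by blast
      qed
      moreover have "V \<subseteq> (\<Inter>n. {w'. \<forall>k<n. w' k = w k})"
        using agree[OF w] g True by auto
      ultimately show ?thesis
        by (intro that[of "\<Inter>n. {w'. \<forall>k<n. w' k = w k}"]) (auto simp: V_def[symmetric])
    next
      case False
      with d_nonneg have d: "0 < ?d" by simp
      \<comment> \<open>The first level whose separation distance is at most \<open>?d\<close>.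
        Members of \<open>V\<close> agree before it, and at it the reciprocal of the slope product
        is at most \<open>?d / g\<close>.\<close>
      define n where "n = (LEAST n. g \<le> branch_prod a b w n * ?d)"
      have "\<exists>n. g \<le> branch_prod a b w n * ?d"
      proof -
        obtain n where "g / ?d < a ^ n" using real_arch_pow[OF a] by blast
        also have "a ^ n \<le> branch_prod a b w n" using a ab by (intro power_le_branch_prod) auto
        finally show ?thesis using d by (auto simp: pos_divide_less_eq intro: less_imp_le)
      qed
      then have n1: "g \<le> branch_prod a b w n * ?d"
        unfolding n_def by (rule LeastI_ex)
      have n2: "branch_prod a b w j * ?d < g" if "j < n" for j
        using not_less_Least[of j "\<lambda>n. g \<le> branch_prod a b w n * ?d"] that by (simp add: n_def)
      \<comment> \<open>Slopes are at most b, so before level \<open>N\<close> points are separated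
        by more than \<open>g / b ^ N\<close>, the largest diameter allowed.\<close>
      have "N \<le> n"
      proof (rule ccontr)
        assume "\<not> N \<le> n"
        have "g \<le> branch_prod a b w n * ?d" by (rule n1)
        also have "\<dots> \<le> b ^ n * (g / b ^ N)"
          using a ab U(2) d_nonneg by (intro mult_mono branch_prod_le_power) auto
        also have "\<dots> < b ^ N * (g / b ^ N)"
          using \<open>\<not> N \<le> n\<close> b g by (intro mult_strict_right_mono power_strict_increasing) auto
        also have "\<dots> = g" using b by simp
        finally show False by simp
      qed
      have "emeasure (coin_measure q) {w'. \<forall>k<n. w' k = w k} = ennreal (branch_prod (1 - q) q w n)"
        using q by (intro emeasure_cylinder) auto
      also have "\<dots> \<le> ennreal ((1 / branch_prod a b w n) powr s)"
        using A[OF wA \<open>N \<le> n\<close>] by (rule ennreal_leI)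
      also have "\<dots> \<le> ennreal ((?d / g) powr s)"
        using n1 g d s branch_prod_ab_pos[of w n]
        by (intro ennreal_leI powr_mono2) (auto simp: field_simps)
      finally have "emeasure (coin_measure q) {w'. \<forall>k<n. w' k = w k} \<le> ennreal ((?d / g) powr s)" .
      moreover have "V \<subseteq> {w'. \<forall>k<n. w' k = w k}"
        using agree[OF w _ _ n2] by blast
      ultimately show ?thesis
        by (intro that[of "{w'. \<forall>k<n. w' k = w k}"]) (auto simp: V_def[symmetric])
    qed
  qed
qed

text \<open>Mass distribution principle for the coin of bias \<open>q\<close>: almost every sequence
  codes a point of the level set, and since s \<alpha> is below the entropy its cylinder masses are
  eventually at most their sizes to the power s.\<close>

lemma hausdorff_measure_level_set_pos:
  assumes q: "0 < q" "q < 1" and s: "0 < s"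
    and alpha: "\<alpha> = (1 - q) * ln a + q * ln b"
    and less: "s * \<alpha> < - (q * ln q + (1 - q) * ln (1 - q))"
  shows "hausdorff_measure s (lyap_level_set a b \<alpha>) \<noteq> 0"
proof -
  let ?M = "coin_measure q" and ?E = "lyap_level_set a b \<alpha>"
  interpret P: prob_space ?M by (rule prob_space_coin_measure)
  define g where "g = 1 - 1 / a - 1 / b"
  have g: "0 < g" using gap by (simp add: g_def)
  \<comment> \<open>The level from which the mass bound holds depends on the sequence; fixing it as
    \<open>N\<close> makes the bound uniform on a set.\<close>
  define light where "light N = {w. \<forall>n\<ge>N. branch_prod (1 - q) q w n \<le> (1 / branch_prod a b w n) powr s}" for N :: nat
  have light_sets: "light N \<in> sets ?M" for N
  proof -
    have "{w \<in> space ?M. branch_prod (1 - q) q w n \<le> (1 / branch_prod a b w n) powr s} \<in> sets ?M" for n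
      by (intro borel_measurable_le powr_real_measurable borel_measurable_divide
        borel_measurable_const measurable_branch_prod)
    then have "(\<Inter>n\<in>{N..}. {w. branch_prod (1 - q) q w n \<le> (1 / branch_prod a b w n) powr s}) \<in> sets ?M"
      using sets.top[of ?M] by (intro sets.countable_INT'') auto
    moreover have "light N = (\<Inter>n\<in>{N..}. {w. branch_prod (1 - q) q w n \<le> (1 / branch_prod a b w n) powr s})"
      by (auto simp: light_def)
    ultimately show ?thesis by simp
  qed
  have light_ex: "\<exists>N. w \<in> light N" if "(\<lambda>n. ones w n / real n) \<longlonglongrightarrow> q" for w
  proof -
    let ?P = "branch_prod a b w" and ?W = "branch_prod (1 - q) q w"
    have "(\<lambda>n. s * (ln (?P n) / real n) + ln (?W n) / real n) \<longlonglongrightarrow>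
        s * ((1 - q) * ln a + q * ln b) + ((1 - q) * ln (1 - q) + q * ln q)"
      using that q a b by (intro tendsto_intros ln_branch_prod_average_tendsto) auto
    moreover have "s * ((1 - q) * ln a + q * ln b) + ((1 - q) * ln (1 - q) + q * ln q) < 0"
      using less unfolding alpha by linarith
    ultimately have "eventually (\<lambda>n. s * (ln (?P n) / real n) + ln (?W n) / real n < 0) sequentially"
      by (rule order_tendstoD(2))
    then obtain N where N: "\<And>n. n \<ge> N \<Longrightarrow> s * (ln (?P n) / real n) + ln (?W n) / real n < 0"
      by (auto simp: eventually_sequentially)
    have "w \<in> light (Suc N)"
      unfolding light_def
    proof (intro CollectI allI impI)
      fix n assume n: "Suc N \<le> n"
      have "(s * ln (?P n) + ln (?W n)) / real n < 0"
        using N[of n] n by (simp add: add_divide_distrib)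
      then have "ln (?W n) < - s * ln (?P n)"
        using n by (simp add: divide_less_0_iff)
      then have "exp (ln (?W n)) < exp (- s * ln (?P n))" by simp
      moreover have "0 < ?W n" using q by (intro branch_prod_pos) auto
      ultimately show "?W n \<le> (1 / ?P n) powr s"
        using branch_prod_ab_pos[of w n] by (simp add: powr_def ln_div)
    qed
    then show ?thesis by blast
  qed
  obtain S where S: "S \<in> sets ?M" "emeasure ?M S = 1" "\<And>w. w \<in> S \<Longrightarrow> (\<lambda>n. ones w n / real n) \<longlonglongrightarrow> q"
  proof -
    have "AE w in ?M. (\<lambda>n. ones w n / real n) \<longlonglongrightarrow> q"
      using q by (intro AE_ones_average_tendsto) auto
    then obtain Z where Z: "{w \<in> space ?M. \<not> (\<lambda>n. ones w n / real n) \<longlonglongrightarrow> q} \<subseteq> Z" "emeasure ?M Z = 0" "Z \<in> sets ?M"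
      by (rule AE_E)
    show ?thesis
    proof (rule that[of "space ?M - Z"])
      show "emeasure ?M (space ?M - Z) = 1"
        using Z P.emeasure_space_1 sets.top[of ?M] by (subst emeasure_Diff_null_set) auto
      show "space ?M - Z \<in> sets ?M" using Z by (intro sets.compl_sets)
    qed (use Z in auto)
  qed
  \<comment> \<open>The sets \<open>light N\<close> together cover \<open>S\<close>, which has mass
    1, so not all the intersections are null.\<close>
  have "\<exists>N. emeasure ?M (S \<inter> light N) \<noteq> 0"
  proof (rule ccontr)
    assume "\<not> ?thesis"
    then have "emeasure ?M (\<Union>N. S \<inter> light N) = 0"
      using S(1) light_sets by (intro emeasure_UN_eq_0) auto
    moreover have "(\<Union>N. S \<inter> light N) = S"
    proof (intro equalityI subsetI)
      fix w assume "w \<in> S"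
      then obtain N where "w \<in> light N" using light_ex[OF S(3)] by blast
      with \<open>w \<in> S\<close> show "w \<in> (\<Union>N. S \<inter> light N)" by blast
    qed blast
    ultimately show False using S(2) by simp
  qed
  then obtain N where N: "emeasure ?M (S \<inter> light N) \<noteq> 0" by blast
  define A where "A = S \<inter> light N"
  have A_sets: "A \<in> sets ?M" using S light_sets by (simp add: A_def)
  have A_level: "coding w \<in> ?E" if "w \<in> A" for w
    using that S(3) alpha by (intro coding_in_level_set) (auto simp: A_def)
  define \<delta> where "\<delta> = g / b ^ N"
  have delta: "\<delta> > 0" using g b by (simp add: \<delta>_def)
  have "ennreal (g powr s) * emeasure ?M A \<le> (\<Sum>i. ennreal (diameter (U i) powr s))"
    if cover: "?E \<subseteq> (\<Union>i. U i)" and U: "\<And>i. bounded (U i) \<and> diameter (U i) \<le> \<delta>" for U :: "nat \<Rightarrow> real set"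
  proof -
    have "\<exists>C. C \<in> sets ?M \<and> {w \<in> A. coding w \<in> U i} \<subseteq> C \<and> emeasure ?M C \<le> ennreal ((diameter (U i) / g) powr s)" for i
    proof (rule mass_of_covering_set[OF q s, of A N "U i"])
      show "branch_prod (1 - q) q w n \<le> (1 / branch_prod a b w n) powr s" if "w \<in> A" "N \<le> n" for w n
        using that by (simp add: A_def light_def)
      show "bounded (U i)" "diameter (U i) \<le> (1 - 1 / a - 1 / b) / b ^ N"
        using U[of i] by (simp_all add: g_def \<delta>_def)
    next
      fix C assume "C \<in> sets ?M" "{w \<in> A. coding w \<in> U i} \<subseteq> C"
        "emeasure ?M C \<le> ennreal ((diameter (U i) / (1 - 1 / a - 1 / b)) powr s)"
      then show "\<exists>C. C \<in> sets ?M \<and> {w \<in> A. coding w \<in> U i} \<subseteq> C \<and>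
          emeasure ?M C \<le> ennreal ((diameter (U i) / g) powr s)"
        unfolding g_def by (intro exI[of _ C] conjI)
    qed
    from choice[OF allI, OF this] obtain C where "\<forall>i. C i \<in> sets ?M \<and> {w \<in> A. coding w \<in> U i} \<subseteq> C i \<and>
        emeasure ?M (C i) \<le> ennreal ((diameter (U i) / g) powr s)" ..
    then have C: "\<And>i. C i \<in> sets ?M" "\<And>i. {w \<in> A. coding w \<in> U i} \<subseteq> C i"
      "\<And>i. emeasure ?M (C i) \<le> ennreal ((diameter (U i) / g) powr s)"
      by simp_all
    have "A \<subseteq> (\<Union>i. C i)" using A_level cover C(2) by blast
    then have "emeasure ?M A \<le> emeasure ?M (\<Union>i. C i)"
      using C by (intro emeasure_mono sets.countable_UN) auto
    also have "\<dots> \<le> (\<Sum>i. emeasure ?M (C i))"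
      using C by (intro emeasure_subadditive_countably) auto
    also have "\<dots> \<le> (\<Sum>i. ennreal ((diameter (U i) / g) powr s))"
      using C by (intro suminf_le summableI) auto
    finally have "ennreal (g powr s) * emeasure ?M A \<le> ennreal (g powr s) * (\<Sum>i. ennreal ((diameter (U i) / g) powr s))"
      by (rule mult_left_mono) simp
    also have "\<dots> = (\<Sum>i. ennreal (g powr s) * ennreal ((diameter (U i) / g) powr s))"
      by simp
    also have "\<dots> = (\<Sum>i. ennreal (diameter (U i) powr s))"
    proof (rule suminf_cong)
      fix i
      have "g powr s * (diameter (U i) / g) powr s = diameter (U i) powr s"
        using g diameter_ge_0[of "U i"] U[of i] by (simp flip: powr_mult)
      then show "ennreal (g powr s) * ennreal ((diameter (U i) / g) powr s) = ennreal (diameter (U i) powr s)"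
        by (simp flip: ennreal_mult)
    qed
    finally show ?thesis .
  qed
  then have "ennreal (g powr s) * emeasure ?M A \<le>
      (INF U\<in>{U :: nat \<Rightarrow> real set. ?E \<subseteq> (\<Union>i. U i) \<and> (\<forall>i. bounded (U i) \<and> diameter (U i) \<le> \<delta>)}.
        (\<Sum>i. ennreal (diameter (U i) powr s)))"
    by (intro INF_greatest) auto
  also have "\<dots> \<le> hausdorff_measure s ?E"
    unfolding hausdorff_measure_def using delta by (intro SUP_upper) auto
  finally have "ennreal (g powr s) * emeasure ?M A \<le> hausdorff_measure s ?E" .
  moreover have "ennreal (g powr s) * emeasure ?M A \<noteq> 0"
    using N g by (simp add: A_def)
  ultimately show ?thesis by auto
qed

end

section \<open>The Lyapunov spectrum\<close>

text \<open>For 0 < p < 1 both bounds use the coin of bias \<open>p\<close> and meet at h /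
  \<alpha>. At the endpoints h = 0 and only the upper bound is needed.\<close>

lemma (in cookie_cutter) lyap_spectrum_eq:
  assumes "\<alpha> \<in> {ln a..ln b}"
  shows "lyap_spectrum a b \<alpha> = entropy_quotient (ln a) (ln b) \<alpha>"
proof -
  define p where "p = (\<alpha> - ln a) / (ln b - ln a)"
  define h where "h = - (p * ln p + (1 - p) * ln (1 - p))"
  have AB: "0 < ln a" "ln a < ln b" using a ab by auto
  have p: "0 \<le> p" "p \<le> 1" using assms AB by (auto simp: p_def)
  have alpha: "0 < \<alpha>" using assms AB by auto
  have alpha_eq: "\<alpha> = (1 - p) * ln a + p * ln b"
    using AB by (simp add: p_def divide_simps) (simp add: algebra_simps)
  have "(ln b - \<alpha>) / (ln b - ln a) = 1 - p"
    using AB by (simp add: p_def divide_simps)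
  then have eq: "entropy_quotient (ln a) (ln b) \<alpha> = h / \<alpha>"
    by (simp add: entropy_quotient_def h_def p_def[symmetric])
  have upper: "hausdorff_measure s (lyap_level_set a b \<alpha>) = 0"
    if "0 < q" "q < 1" "0 < s" "- (p * ln q + (1 - p) * ln (1 - q)) < s * \<alpha>" for q s
    using that by (intro hausdorff_measure_level_set_eq_0[OF _ _ _ p_def])
  have "hausdorff_dim (lyap_level_set a b \<alpha>) = h / \<alpha>"
  proof (cases "0 < p \<and> p < 1")
    case True
    then have "p * ln p \<le> 0" "(1 - p) * ln (1 - p) \<le> 0"
      by (auto intro!: mult_nonneg_nonpos)
    then have h: "0 \<le> h / \<alpha>" using alpha by (simp add: h_def)
    show ?thesis
    proof (rule hausdorff_dim_eqI[OF h])
      fix s assume s: "h / \<alpha> < s"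
      then have "h < s * \<alpha>" using alpha by (simp add: pos_divide_less_eq)
      then show "hausdorff_measure s (lyap_level_set a b \<alpha>) = 0"
        using True h s by (intro upper[of p]) (auto simp: h_def)
    next
      fix s assume s: "0 < s" "s < h / \<alpha>"
      then have "s * \<alpha> < h" using alpha by (simp add: pos_less_divide_eq)
      then show "hausdorff_measure s (lyap_level_set a b \<alpha>) \<noteq> 0"
        using True s by (intro hausdorff_measure_level_set_pos[OF _ _ _ alpha_eq]) (auto simp: h_def)
    qed
  next
    case False
    with p have p01: "p = 0 \<or> p = 1" by auto
    then have h: "h = 0" by (auto simp: h_def)
    show ?thesis
      unfolding h
    proof (rule hausdorff_dim_eqI)
      fix s assume "0 / \<alpha> < s"
      then have s: "0 < s" by simp
      \<comment> \<open>At an endpoint a coin strictly between 0 and 1 must replace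
        \<open>p\<close>. The symbol of frequency 1 gets weight t, at cost - ln t = s \<alpha> / 2
        per letter, which is below s \<alpha>.\<close>
      define t where "t = exp (- (s * \<alpha> / 2))"
      have t: "0 < t" "t < 1" "- ln t < s * \<alpha>"
        using s alpha by (auto simp: t_def)
      show "hausdorff_measure s (lyap_level_set a b \<alpha>) = 0"
        using p01
      proof
        assume "p = 0"
        then show ?thesis using t s by (intro upper[of "1 - t"]) auto
      next
        assume "p = 1"
        then show ?thesis using t s by (intro upper[of t]) auto
      qed
    qed auto
  qed
  then show ?thesis by (simp add: lyap_spectrum_def eq)
qed

theorem theoremA:
  fixes a b :: real
  assumes "1 < a" and "a < b" and "1/a < 1 - 1/b"
  shows "concave_on {ln a..ln b} (lyap_spectrum a b) \<longleftrightarrow>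
         ln b / ln a \<le> (sqrt (2 * ln 2) + 1) / (sqrt (2 * ln 2) - 1)"
proof -
  interpret cookie_cutter a b by standard (use assms in auto)
  \<comment> \<open>The two functions are known to agree only on the closed interval; its convexity
    keeps every convex combination inside.\<close>
  have "concave_on {ln a..ln b} (lyap_spectrum a b) \<longleftrightarrow>
      concave_on {ln a..ln b} (entropy_quotient (ln a) (ln b))"
    using lyap_spectrum_eq convexD[OF convex_real_interval(5), of _ "ln a" "ln b"]
    unfolding concave_on_iff by (simp del: real_scaleR_def atLeastAtMost_iff cong: ball_cong)
  then show ?thesis
    using assms by (simp add: concave_on_entropy_quotient_iff)
qed

end
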